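(* Let $d\ge1$ be an integer, let $\lambda_0\ge\lambda>0$ be real numbers, let $(e_1,\ldots,e_d)$ be the canonical basis of $\mathbb R^d$, and let $\gamma_d$ be the probability that a simple symmetric random walk on $\mathbb Z^d$ started at $0$ never returns to $0$. For a probability measure $\nu$ on $\mathbb Z^d$, write $\nu_x=\nu(\{x\})$ and consider the system of equations $$(\ast)\qquad (1+(\lambda_0-\lambda)\nu_0)\,\nu_x=\frac1{2d}\sum_{i=1}^d(\nu_{x+e_i}+\nu_{x-e_i})\qquad\text{for all }x\in\mathbb Z^d\setminus\{0\}.$$ (i) If $0\le\lambda_0-\lambda\le\gamma_d$, then there exists no probability measure $\nu$ on $\mathbb Z^d$ satisfying $(\ast)$. (ii) If $\lambda_0-\lambda>\gamma_d$, then there exists a unique probability measure $\nu$ on $\mathbb Z^d$ satisfying $(\ast)$.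
   Context: The simple symmetric random walk on $\mathbb Z^d$ moves at each step to one of the $2d$ nearest neighbours of its current position, chosen uniformly at random. *)

theory Defs
  imports "HOL-Probability.Probability"
begin

text \<open>The lattice of dimension \<open>d \<ge> 1\<close> is the type \<open>int ^ 'd\<close>, with \<open>d = CARD('d)\<close>; the canonical basis
  vectors are \<open>axis i 1\<close>.\<close>

definition lattice_neighbours_0 :: "(int ^ 'd::finite) set" where
  "lattice_neighbours_0 = (\<Union>i. {axis i 1, - axis i 1})"

definition srw_increments :: "(nat \<Rightarrow> int ^ 'd::finite) measure" where
  "srw_increments = (\<Pi>\<^sub>M n\<in>UNIV. measure_pmf (pmf_of_set lattice_neighbours_0))"

definition srw_position :: "(nat \<Rightarrow> int ^ 'd::finite) \<Rightarrow> nat \<Rightarrow> int ^ 'd" where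
  "srw_position \<xi> n = (\<Sum>k<n. \<xi> k)"

definition srw_escape_prob :: "'d::finite itself \<Rightarrow> real" where
  "srw_escape_prob _ =
     measure (srw_increments :: (nat \<Rightarrow> int ^ 'd) measure)
       {\<xi> \<in> space srw_increments. \<forall>n\<ge>1. srw_position \<xi> n \<noteq> 0}"

definition satisfies_system :: "real \<Rightarrow> real \<Rightarrow> (int ^ 'd::finite) pmf \<Rightarrow> bool" where
  "satisfies_system lam0 lam \<nu> \<longleftrightarrow>
     (\<forall>x. x \<noteq> 0 \<longrightarrow>
        (1 + (lam0 - lam) * pmf \<nu> 0) * pmf \<nu> x =
          1 / (2 * real CARD('d)) * (\<Sum>i\<in>UNIV. pmf \<nu> (x + axis i 1) + pmf \<nu> (x - axis i 1)))"

lemma finite_lattice_neighbours_0: "finite (lattice_neighbours_0 :: (int ^ 'd::finite) set)"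
  and lattice_neighbours_0_nonempty: "lattice_neighbours_0 \<noteq> ({} :: (int ^ 'd::finite) set)"
  by (auto simp: lattice_neighbours_0_def)

lemma card_lattice_neighbours_0:
  "card (lattice_neighbours_0 :: (int ^ 'd::finite) set) = 2 * CARD('d)"
proof -
  have ne: "axis i (1::int) \<noteq> - axis j 1" for i j :: 'd
  proof
    assume "axis i (1::int) = - axis j 1"
    then have "axis i (1::int) $ i = (- axis j 1) $ i" by simp
    then show False by (simp add: axis_def split: if_splits)
  qed
  have "card (\<Union>i::'d. {axis i (1::int), - axis i 1}) = (\<Sum>i::'d\<in>UNIV. card {axis i (1::int), - axis i 1})"
    using ne ne[symmetric] by (intro card_UN_disjoint) (auto simp: axis_eq_axis)
  also have "\<dots> = 2 * CARD('d)"
    using ne by simp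
  finally show ?thesis by (simp add: lattice_neighbours_0_def)
qed

lemma prob_space_srw_increments: "prob_space srw_increments"
  unfolding srw_increments_def by (intro prob_space_PiM prob_space_measure_pmf)

lemma srw_position_measurable:
  "(\<lambda>\<xi>. srw_position \<xi> n) \<in> srw_increments \<rightarrow>\<^sub>M (count_space UNIV :: (int ^ 'd::finite) measure)"
proof (induction n)
  case 0
  then show ?case by (simp add: srw_position_def)
next
  case (Suc n)
  have comp: "(\<lambda>\<xi>. \<xi> n) \<in> srw_increments \<rightarrow>\<^sub>M (count_space UNIV :: (int ^ 'd::finite) measure)"
    unfolding srw_increments_def
    using measurable_component_singleton[of n UNIV "\<lambda>_. measure_pmf (pmf_of_set lattice_neighbours_0)"]
    by (simp cong: measurable_cong_sets)
  have "(\<lambda>\<xi>. srw_position \<xi> n + \<xi> n) \<in> srw_increments \<rightarrow>\<^sub>M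
      (count_space UNIV :: (int ^ 'd::finite) measure)"
    by (rule measurable_compose_countable[OF _ comp]) (rule measurable_compose[OF Suc], simp)
  then show ?case by (simp add: srw_position_def)
qed

lemma srw_escape_event_measurable:
  "{\<xi> \<in> space srw_increments. \<forall>n\<ge>1. srw_position \<xi> n \<noteq> (0 :: int ^ 'd::finite)} \<in> sets srw_increments"
proof -
  note srw_position_measurable[measurable]
  show ?thesis by measurable
qed

end

theory Submission
  imports Defs
begin

text \<open>
  Write \<open>P\<close> for the one-step operator of the walk, \<open>\<delta> = lam0 - lam\<close>, and
  \<open>s = 1 / (1 + \<delta> * \<nu> 0)\<close>, so that \<open>0 < s \<le> 1\<close>. The system says \<open>\<nu> = s * P \<nu>\<close> off the origin.
  Summing over \<open>x \<noteq> 0\<close> determines the defect at the origin from the fact that both \<open>\<nu>\<close> and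
  \<open>P \<nu>\<close> have mass one, and the system becomes the equation
  \<open>\<nu> = (1 - s) * \<one>\<^sub>0 + s * P \<nu>\<close> on the whole lattice, where \<open>\<one>\<^sub>0\<close> is the
  indicator function of the origin (\<open>satisfies_system_imp_killed_walk_equation\<close>).
  The value \<open>s = 1\<close> is impossible, since by the maximum principle no probability measure is invariant under the walk (\<open>no_invariant_pmf\<close>). For
  \<open>s < 1\<close> the right-hand side is a contraction in the supremum norm, and its fixed point is the law of
  the walk at an independent geometric time, \<open>\<nu> = (1 - s) * (\<Sum>n. s ^ n * P ^ n \<one>\<^sub>0)\<close>. In particular
  \<open>\<nu> 0 = (1 - s) * G s\<close>, where \<open>G s = (\<Sum>n. p n * s ^ n)\<close> is the generating function of the return
  probabilities \<open>p n\<close>, and the relation \<open>s * (1 + \<delta> * \<nu> 0) = 1\<close> between \<open>s\<close> and \<open>\<nu>\<close> reduces to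
  \<open>\<delta> * (s * G s) = 1\<close>.

  Solutions of the system thus correspond to solutions \<open>s\<close> of \<open>\<delta> * (s * G s) = 1\<close> in the open
  interval from 0 to 1. The function \<open>s * G s\<close> is continuous and strictly increasing, and it remains to
  show that its supremum, which is not attained, is the inverse of the escape probability \<open>\<gamma>\<close>, and
  infinite if \<open>\<gamma> = 0\<close>. Splitting according to the last visit to the origin up to time \<open>n\<close> gives \<open>(\<Sum>k\<le>n. p k * r (n - k)) = 1\<close>, where \<open>r m\<close> is the
  probability of no return during the first \<open>m\<close> steps (\<open>last_visit_decomposition\<close>), hence
  \<open>G s * (\<Sum>m. r m * s ^ m) = 1 / (1 - s)\<close>. As \<open>r m\<close> decreases to \<open>\<gamma>\<close>, this yields
  \<open>\<gamma> * (s * G s) < 1\<close> for all \<open>s\<close> between 0 and 1 (\<open>escape_prob_times_return_gf_less_1\<close>), and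
  \<open>\<delta> * (s * G s) > 1\<close> for \<open>s\<close> close to 1 whenever \<open>\<delta> > \<gamma>\<close> (\<open>ex_return_gf_greater\<close>).
\<close>

section \<open>The transition operator and the law of the walk\<close>

text \<open>The law after one more step of the walk, started from the law \<open>\<nu>\<close>. The increment is sampled first;
  as \<open>\<nu>\<close> and the increment are independent, the order is immaterial.\<close>
definition srw_step :: "(int ^ 'd::finite) pmf \<Rightarrow> (int ^ 'd) pmf" where
  "srw_step \<nu> = bind_pmf (pmf_of_set lattice_neighbours_0) (\<lambda>e. map_pmf ((+) e) \<nu>)"

text \<open>The law of the walk from the origin after \<open>n\<close> steps, defined by recursion; that it is the law of
  \<open>srw_position\<close> is shown in \<open>emeasure_srw_position\<close>.\<close>
primrec srw_law :: "nat \<Rightarrow> (int ^ 'd::finite) pmf" where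
  "srw_law 0 = return_pmf 0"
| "srw_law (Suc n) = srw_step (srw_law n)"

lemma pmf_map_translate: "pmf (map_pmf ((+) e) \<nu>) x = pmf \<nu> (x - e)"
  for e :: "'a::ab_group_add"
  using pmf_map_inj'[of "(+) e" \<nu> "x - e"] by simp

lemma sum_lattice_neighbours_0:
  fixes f :: "int ^ 'd::finite \<Rightarrow> real"
  shows "(\<Sum>e\<in>lattice_neighbours_0. f e) = (\<Sum>i\<in>UNIV. f (axis i 1) + f (- axis i 1))"
proof -
  have ne: "axis i (1::int) \<noteq> - axis j 1" for i j :: 'd
  proof
    assume "axis i (1::int) = - axis j 1"
    then have "axis i (1::int) $ i = (- axis j 1) $ i" by simp
    then show False by (simp add: axis_def split: if_splits)
  qed
  have "(\<Sum>e\<in>lattice_neighbours_0. f e) = (\<Sum>i\<in>UNIV. \<Sum>e\<in>{axis i 1, - axis i 1}. f e)"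
    unfolding lattice_neighbours_0_def using ne ne[symmetric]
    by (intro sum.UNION_disjoint) (auto simp: axis_eq_axis)
  then show ?thesis using ne by simp
qed

lemma pmf_srw_step:
  fixes \<nu> :: "(int ^ 'd::finite) pmf"
  shows "pmf (srw_step \<nu>) x =
    1 / (2 * real CARD('d)) * (\<Sum>i\<in>UNIV. pmf \<nu> (x + axis i 1) + pmf \<nu> (x - axis i 1))"
  by (simp add: srw_step_def pmf_bind pmf_map_translate integral_pmf_of_set
      finite_lattice_neighbours_0 lattice_neighbours_0_nonempty card_lattice_neighbours_0
      sum_lattice_neighbours_0 add.commute)

lemma satisfies_system_iff:
  "satisfies_system lam0 lam \<nu> \<longleftrightarrow>
    (\<forall>x. x \<noteq> 0 \<longrightarrow> (1 + (lam0 - lam) * pmf \<nu> 0) * pmf \<nu> x = pmf (srw_step \<nu>) x)"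
  by (simp add: satisfies_system_def pmf_srw_step)

section \<open>Reduction to the killed walk equation\<close>

text \<open>The equation satisfied by the law of the position at which the walk from the origin is killed, if it
  survives each step with probability \<open>s\<close>: it is killed at the origin before its first step, or it
  makes a step first. For \<open>s = 1\<close> it says that \<open>\<nu>\<close> is invariant.\<close>
definition killed_walk_equation :: "real \<Rightarrow> (int ^ 'd::finite) pmf \<Rightarrow> bool" where
  "killed_walk_equation s \<nu> \<longleftrightarrow>
     (\<forall>x. pmf \<nu> x = (1 - s) * indicator {0} x + s * pmf (srw_step \<nu>) x)"

lemma infsetsum_pmf_compl_singleton: "infsetsum (pmf \<nu>) (- {a}) = 1 - pmf \<nu> a"
  using measure_pmf.prob_compl[of "{a}" \<nu>]
  by (simp add: measure_pmf_conv_infsetsum[symmetric] Compl_eq_Diff_UNIV measure_pmf_single)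

text \<open>The system says nothing about the origin. The missing equation there comes from summing all the
  others: both \<open>\<nu>\<close> and its image under the step have total mass one.\<close>
lemma satisfies_system_imp_killed_walk_equation:
  fixes \<nu> :: "(int ^ 'd::finite) pmf"
  assumes "satisfies_system lam0 lam \<nu>" and "lam0 \<ge> lam"
  defines "s \<equiv> 1 / (1 + (lam0 - lam) * pmf \<nu> 0)"
  shows "killed_walk_equation s \<nu>"
proof -
  define th where "th = 1 + (lam0 - lam) * pmf \<nu> 0"
  have th: "th \<ge> 1" using assms(2) by (simp add: th_def)
  have off: "th * pmf \<nu> x = pmf (srw_step \<nu>) x" if "x \<noteq> 0" for x
    using assms(1) that by (simp add: satisfies_system_iff th_def)
  have "th * infsetsum (pmf \<nu>) (- {0}) = infsetsum (\<lambda>x. th * pmf \<nu> x) (- {0})"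
    by (intro infsetsum_cmult_right[symmetric] pmf_abs_summable)
  also have "\<dots> = infsetsum (pmf (srw_step \<nu>)) (- {0})"
    using off by (intro infsetsum_cong) auto
  finally have at0: "th * (1 - pmf \<nu> 0) = 1 - pmf (srw_step \<nu>) 0"
    by (simp add: infsetsum_pmf_compl_singleton)
  show ?thesis
    unfolding killed_walk_equation_def
  proof
    fix x :: "int ^ 'd"
    show "pmf \<nu> x = (1 - s) * indicator {0} x + s * pmf (srw_step \<nu>) x"
    proof (cases "x = 0")
      case True
      have "pmf \<nu> 0 = (th - 1 + pmf (srw_step \<nu>) 0) / th"
        using at0 th by (simp add: eq_divide_eq right_diff_distrib mult.commute)
      then show ?thesis using True th unfolding s_def th_def[symmetric]
        by (simp add: add_divide_distrib diff_divide_distrib)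
    next
      case False
      then show ?thesis using off[OF False] th unfolding s_def th_def[symmetric]
        by (simp add: field_simps)
    qed
  qed
qed

lemma killed_walk_equation_imp_satisfies_system:
  fixes \<nu> :: "(int ^ 'd::finite) pmf"
  assumes "killed_walk_equation s \<nu>" and "s > 0" and "s * (1 + (lam0 - lam) * pmf \<nu> 0) = 1"
  shows "satisfies_system lam0 lam \<nu>"
  unfolding satisfies_system_iff
proof (intro allI impI)
  fix x :: "int ^ 'd" assume "x \<noteq> 0"
  then have "pmf \<nu> x = s * pmf (srw_step \<nu>) x"
    using assms(1) unfolding killed_walk_equation_def by force
  moreover have "1 + (lam0 - lam) * pmf \<nu> 0 = 1 / s"
    using assms(2,3) by (simp add: eq_divide_eq mult.commute)
  ultimately show "(1 + (lam0 - lam) * pmf \<nu> 0) * pmf \<nu> x = pmf (srw_step \<nu>) x"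
    using assms(2) by simp
qed

section \<open>Existence and uniqueness for the killed walk equation\<close>

text \<open>The law of the walk from the origin at an independent geometric time: time \<open>n\<close> has probability
  \<open>(1 - s) * s ^ n\<close>. It is meaningful for \<open>0 \<le> s < 1\<close>.\<close>
definition killed_walk_law :: "real \<Rightarrow> (int ^ 'd::finite) pmf" where
  "killed_walk_law s = bind_pmf (geometric_pmf (1 - s)) srw_law"

text \<open>The generating function of the probabilities of being at the origin after \<open>n\<close> steps, that is, the
  discounted Green function of the walk at the origin. The series converges for \<open>0 \<le> s < 1\<close>.\<close>
definition return_gf :: "'d::finite itself \<Rightarrow> real \<Rightarrow> real" where
  "return_gf _ s = (\<Sum>n. pmf (srw_law n :: (int ^ 'd) pmf) 0 * s ^ n)"

lemma killed_walk_equation_killed_walk_law: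
  fixes s :: real
  assumes "0 \<le> s" "s < 1"
  shows "killed_walk_equation s (killed_walk_law s :: (int ^ 'd::finite) pmf)"
proof -
  have step: "bind_pmf (geometric_pmf (1 - s)) (\<lambda>n. srw_step (srw_law n)) =
      srw_step (killed_walk_law s :: (int ^ 'd) pmf)"
    unfolding srw_step_def killed_walk_law_def
    by (subst bind_commute_pmf) (simp add: map_bind_pmf)
  \<comment> \<open>A geometric variable is 0 with probability \<open>1 - s\<close>, and otherwise one plus a copy of itself.\<close>
  have eq: "killed_walk_law s = bind_pmf (bernoulli_pmf (1 - s))
      (\<lambda>b. if b then return_pmf 0 else srw_step (killed_walk_law s :: (int ^ 'd) pmf))"
    unfolding step[symmetric]
    using assms unfolding killed_walk_law_def
    by (subst geometric_bind_pmf_unfold)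
      (auto simp: bind_assoc_pmf bind_return_pmf bind_map_pmf intro!: bind_pmf_cong)
  have "pmf (killed_walk_law s) x = (1 - s) * indicator {0} x
      + s * pmf (srw_step (killed_walk_law s)) x" for x :: "int ^ 'd"
    using arg_cong[OF eq, of "\<lambda>\<nu>. pmf \<nu> x"] assms
    by (simp add: pmf_bind[of "bernoulli_pmf _"] indicator_def)
  then show ?thesis by (simp add: killed_walk_equation_def)
qed

lemma summable_bounded_powser:
  fixes a :: "nat \<Rightarrow> real"
  assumes "\<And>n. \<bar>a n\<bar> \<le> 1" "0 \<le> s" "s < 1"
  shows "summable (\<lambda>n. \<bar>a n * s ^ n\<bar>)"
  using assms
  by (intro summable_comparison_test'[OF summable_geometric[of s], of 0])
    (auto simp: abs_mult mult_left_le_one_le)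

lemma summable_return_gf:
  assumes "0 \<le> s" "s < 1"
  shows "summable (\<lambda>n. pmf (srw_law n :: (int ^ 'd::finite) pmf) 0 * s ^ n)"
  using summable_bounded_powser[OF _ assms, of "\<lambda>n. pmf (srw_law n :: (int ^ 'd) pmf) 0"]
  by (auto simp: pmf_le_1 intro: summable_rabs_cancel)

lemma pmf_killed_walk_law_0:
  assumes "0 \<le> s" "s < 1"
  shows "pmf (killed_walk_law s :: (int ^ 'd::finite) pmf) 0 = (1 - s) * return_gf TYPE('d) s"
proof -
  let ?p = "\<lambda>n. pmf (srw_law n :: (int ^ 'd) pmf) 0"
  have sm: "summable (\<lambda>n. ?p n * s ^ n)"
    using assms by (rule summable_return_gf)
  have "pmf (killed_walk_law s :: (int ^ 'd) pmf) 0 =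
      (\<integral>n. (s ^ n * (1 - s)) * ?p n \<partial>count_space UNIV)"
    using assms unfolding killed_walk_law_def
    by (simp add: pmf_bind measure_pmf_eq_density integral_density)
  also have "\<dots> = (\<Sum>n. (s ^ n * (1 - s)) * ?p n)"
    using summable_mult[OF sm, of "1 - s"] assms
    by (intro integral_count_space_nat)
      (simp add: integrable_count_space_nat_iff abs_mult mult_ac)
  also have "\<dots> = (1 - s) * return_gf TYPE('d) s"
    unfolding return_gf_def by (subst suminf_mult[OF sm, symmetric]) (simp add: mult_ac)
  finally show ?thesis .
qed

text \<open>The difference of two solutions is bounded by one and contracted by \<open>s\<close> in the supremum norm.\<close>
lemma killed_walk_equation_unique:
  fixes \<nu> \<mu> :: "(int ^ 'd::finite) pmf"
  assumes "killed_walk_equation s \<nu>" "killed_walk_equation s \<mu>" "0 \<le> s" "s < 1"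
  shows "\<nu> = \<mu>"
proof -
  define D where "D x = \<bar>pmf \<nu> x - pmf \<mu> x\<bar>" for x
  have bdd: "D x \<le> 1" for x
    using pmf_le_1[of \<nu> x] pmf_le_1[of \<mu> x] pmf_nonneg[of \<nu> x] pmf_nonneg[of \<mu> x]
    unfolding D_def by linarith
  have contr: "D x \<le> s * K" if K: "\<And>y. D y \<le> K" for x K
  proof -
    have "pmf (srw_step \<nu>) x - pmf (srw_step \<mu>) x = 1 / (2 * real CARD('d)) *
        (\<Sum>i\<in>UNIV. (pmf \<nu> (x + axis i 1) - pmf \<mu> (x + axis i 1))
          + (pmf \<nu> (x - axis i 1) - pmf \<mu> (x - axis i 1)))"
      unfolding pmf_srw_step right_diff_distrib[symmetric] sum_subtractf[symmetric]
      by (simp add: algebra_simps)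
    also have "\<bar>\<dots>\<bar> \<le> 1 / (2 * real CARD('d)) * (\<Sum>i\<in>(UNIV :: 'd set). 2 * K)"
    proof -
      have "\<bar>(pmf \<nu> (x + axis i 1) - pmf \<mu> (x + axis i 1))
          + (pmf \<nu> (x - axis i 1) - pmf \<mu> (x - axis i 1))\<bar> \<le> 2 * K" for i
        using K[of "x + axis i 1"] K[of "x - axis i 1"] unfolding D_def by linarith
      then show ?thesis
        unfolding abs_mult by (intro mult_mono order_trans[OF sum_abs] sum_mono) auto
    qed
    also have "\<dots> = K" by simp
    finally have "\<bar>pmf (srw_step \<nu>) x - pmf (srw_step \<mu>) x\<bar> \<le> K" .
    moreover have "pmf \<nu> x - pmf \<mu> x = s * (pmf (srw_step \<nu>) x - pmf (srw_step \<mu>) x)"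
      using assms(1,2) unfolding killed_walk_equation_def
      by (metis add_diff_cancel_left right_diff_distrib)
    ultimately show ?thesis
      unfolding D_def using assms(3) by (simp add: abs_mult mult_left_mono)
  qed
  have "D x \<le> s ^ n" for x n
    by (induction n arbitrary: x) (auto simp: bdd contr)
  then have "D x \<le> 0" for x
    using assms(3,4) by (intro LIMSEQ_le_const[OF LIMSEQ_realpow_zero]) auto
  then show ?thesis by (intro pmf_eqI) (simp add: D_def)
qed

text \<open>The maximum principle: an invariant law attains its maximum, as only finitely many points have mass
  above a given positive level; the maximum propagates to all neighbours, hence along an infinite ray.\<close>
lemma no_invariant_pmf:
  fixes \<nu> :: "(int ^ 'd::finite) pmf"
  shows "srw_step \<nu> \<noteq> \<nu>"
proof
  assume inv: "srw_step \<nu> = \<nu>"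
  obtain z where z: "pmf \<nu> z > 0"
    using set_pmf_not_empty[of \<nu>] pmf_positive[of _ \<nu>] by (meson ex_in_conv)
  have fin: "finite {y. c \<le> pmf \<nu> y}" if "c > 0" for c
  proof (rule ccontr)
    assume "infinite {y. c \<le> pmf \<nu> y}"
    then obtain B where B: "finite B" "card B = nat \<lceil>1 / c\<rceil> + 1" "B \<subseteq> {y. c \<le> pmf \<nu> y}"
      using infinite_arbitrarily_large by blast
    have "1 / c < real (card B)"
      using B(2) le_of_int_ceiling[of "1 / c"] by linarith
    then have "1 < real (card B) * c"
      using that by (simp add: field_simps)
    also have "\<dots> \<le> (\<Sum>y\<in>B. pmf \<nu> y)" using B(3) sum_bounded_below[of B c "pmf \<nu>"] by auto
    also have "\<dots> \<le> 1" using B(1) by (simp add: measure_measure_pmf_finite[symmetric])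
    finally show False by simp
  qed
  \<comment> \<open>Mass at least that of \<open>z\<close> is found in a finite set only, over which the maximum is taken.\<close>
  define A where "A = {y. pmf \<nu> z \<le> pmf \<nu> y}"
  have A: "finite A" "z \<in> A" using fin[OF z] by (auto simp: A_def)
  define m where "m = Max (pmf \<nu> ` A)"
  have "m \<in> pmf \<nu> ` A" using A unfolding m_def by (intro Max_in) auto
  then obtain a where a: "pmf \<nu> a = m" by auto
  have m_ge: "pmf \<nu> z \<le> m" using A by (simp add: m_def)
  have m_max: "pmf \<nu> y \<le> m" for y
  proof (cases "y \<in> A")
    case True then show ?thesis using A by (simp add: m_def)
  next
    case False then show ?thesis using m_ge by (simp add: A_def)
  qed
  have spread: "pmf \<nu> (x + axis j 1) = m" if x: "pmf \<nu> x = m" for x and j :: 'd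
  proof -
    let ?f = "\<lambda>i. (m - pmf \<nu> (x + axis i 1)) + (m - pmf \<nu> (x - axis i 1))"
    have "(\<Sum>i\<in>(UNIV :: 'd set). ?f i) = 0"
      using inv x pmf_srw_step[of \<nu> x]
      by (simp add: sum.distrib sum_subtractf field_simps)
    moreover have "0 \<le> ?f i" for i
      using m_max[of "x + axis i 1"] m_max[of "x - axis i 1"] by linarith
    ultimately have "?f j = 0"
      using sum_nonneg_eq_0_iff[of UNIV ?f] by simp
    then show ?thesis using m_max[of "x + axis j 1"] m_max[of "x - axis j 1"] by linarith
  qed
  obtain j :: 'd where True by simp
  have ray: "pmf \<nu> (a + axis j (int k)) = m" for k
  proof (induction k)
    case 0
    have "axis j (int 0) = 0" by (simp add: axis_def vec_eq_iff)
    then show ?case by (simp only: a add_0_right)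
  next
    case (Suc k)
    have "a + axis j (int (Suc k)) = (a + axis j (int k)) + axis j 1"
      by (simp add: axis_def vec_eq_iff)
    then show ?case using spread[OF Suc, of j] by (simp only:)
  qed
  have "inj (\<lambda>k. a + axis j (int k))"
    by (auto intro!: injI simp: axis_eq_axis)
  moreover have "range (\<lambda>k. a + axis j (int k)) \<subseteq> {y. m \<le> pmf \<nu> y}"
    using ray by auto
  moreover have "finite {y. m \<le> pmf \<nu> y}" using fin m_ge z by simp
  ultimately show False using finite_subset finite_imageD infinite_UNIV_nat by metis
qed

section \<open>Solutions of the system as roots of a scalar equation\<close>

text \<open>Every solution of the system is the law of a killed walk, with \<open>s\<close> a root of a scalar equation.\<close>
lemma satisfies_system_imp_killed_walk_law:
  fixes \<nu> :: "(int ^ 'd::finite) pmf"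
  assumes sys: "satisfies_system lam0 lam \<nu>" and le: "lam0 \<ge> lam"
  obtains s where "0 < s" "s < 1" "\<nu> = killed_walk_law s"
    "(lam0 - lam) * (s * return_gf TYPE('d) s) = 1"
proof -
  define \<delta> where "\<delta> = lam0 - lam"
  define s where "s = 1 / (1 + \<delta> * pmf \<nu> 0)"
  have eq: "killed_walk_equation s \<nu>"
    using satisfies_system_imp_killed_walk_equation[OF sys le] by (simp add: s_def \<delta>_def)
  have pos: "1 + \<delta> * pmf \<nu> 0 \<ge> 1" using le by (simp add: \<delta>_def)
  then have s: "0 < s" "s \<le> 1" by (auto simp: s_def)
  have "s \<noteq> 1"
  proof
    assume "s = 1"
    then have "srw_step \<nu> = \<nu>"
      using eq by (intro pmf_eqI) (simp add: killed_walk_equation_def)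
    then show False using no_invariant_pmf by blast
  qed
  with s have s1: "s < 1" by simp
  have \<nu>: "\<nu> = killed_walk_law s"
    using killed_walk_equation_unique[OF eq killed_walk_equation_killed_walk_law] s s1 by simp
  have "s * (1 + \<delta> * pmf \<nu> 0) = 1" using pos by (simp add: s_def)
  then have "(1 - s) * (\<delta> * (s * return_gf TYPE('d) s)) = (1 - s) * 1"
    unfolding \<nu> using s s1 by (simp add: pmf_killed_walk_law_0 algebra_simps)
  then have "\<delta> * (s * return_gf TYPE('d) s) = 1" using s1 by simp
  then show thesis using that s s1 \<nu> by (simp add: \<delta>_def)
qed

lemma satisfies_system_killed_walk_law:
  assumes "0 < s" "s < 1" "(lam0 - lam) * (s * return_gf TYPE('d::finite) s) = 1"
  shows "satisfies_system lam0 lam (killed_walk_law s :: (int ^ 'd) pmf)"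
proof (rule killed_walk_equation_imp_satisfies_system)
  show "s * (1 + (lam0 - lam) * pmf (killed_walk_law s :: (int ^ 'd) pmf) 0) = 1"
  proof -
    have "s * (1 + (lam0 - lam) * ((1 - s) * return_gf TYPE('d) s)) =
        s + (1 - s) * ((lam0 - lam) * (s * return_gf TYPE('d) s))"
      by (simp add: algebra_simps)
    then show ?thesis using assms by (simp add: pmf_killed_walk_law_0)
  qed
qed (use assms in \<open>simp_all add: killed_walk_equation_killed_walk_law\<close>)

section \<open>The path space of the walk\<close>

lemma space_srw_increments: "space (srw_increments :: (nat \<Rightarrow> int ^ 'd::finite) measure) = UNIV"
  by (simp add: srw_increments_def space_PiM)

lemma sets_srw_position:
  "{\<xi>. srw_position \<xi> n = (x :: int ^ 'd::finite)} \<in> sets srw_increments"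
  using measurable_sets[OF srw_position_measurable[of n], of "{x}"]
  by (simp add: space_srw_increments vimage_def)

lemma sets_no_return:
  assumes "finite J"
  shows "{\<xi>. \<forall>j\<in>J. srw_position \<xi> j \<noteq> (0 :: int ^ 'd::finite)} \<in> sets srw_increments"
proof -
  note srw_position_measurable[measurable]
  have "{\<xi> \<in> space srw_increments. \<forall>j\<in>J. srw_position \<xi> j \<noteq> (0 :: int ^ 'd)} \<in> sets srw_increments"
    using assms by measurable
  then show ?thesis by (simp add: space_srw_increments)
qed

lemma sequence_space_increments:
  "sequence_space (measure_pmf (pmf_of_set (lattice_neighbours_0 :: (int ^ 'd::finite) set)))"
  by (simp add: sequence_space_def product_prob_space_def product_prob_space_axioms_def
      product_sigma_finite_def measure_pmf.sigma_finite_measure_axioms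
      measure_pmf.prob_space_axioms)

lemma sigma_finite_srw_increments: "sigma_finite_measure srw_increments"
  by (intro finite_measure.axioms(1) prob_space.finite_measure prob_space_srw_increments)

lemma srw_position_case_nat: "srw_position (case_nat e \<xi>) (Suc n) = e + srw_position \<xi> n"
  by (simp add: srw_position_def sum.lessThan_Suc_shift del: sum.lessThan_Suc)

lemma srw_position_comb_seq_le:
  "j \<le> k \<Longrightarrow> srw_position (comb_seq k \<xi> \<xi>') j = srw_position \<xi> j"
  by (auto simp: srw_position_def comb_seq_less intro!: sum.cong)

lemma srw_position_comb_seq_add:
  "srw_position (comb_seq k \<xi> \<xi>') (k + j) = srw_position \<xi> k + srw_position \<xi>' j"
proof (induction j)
  case 0
  then show ?case by (simp add: srw_position_comb_seq_le) (simp add: srw_position_def)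
next
  case (Suc j)
  then show ?case using comb_seq_add[of k \<xi> \<xi>' j]
    by (simp add: srw_position_def add_ac)
qed

text \<open>By splitting off the first increment.\<close>
lemma emeasure_srw_position:
  fixes x :: "int ^ 'd::finite"
  shows "emeasure srw_increments {\<xi>. srw_position \<xi> n = x} = ennreal (pmf (srw_law n) x)"
proof (induction n arbitrary: x)
  case 0
  have "emeasure srw_increments (UNIV :: (nat \<Rightarrow> int ^ 'd) set) = 1"
    using prob_space.emeasure_space_1[OF prob_space_srw_increments]
    by (simp add: space_srw_increments)
  then show ?case
    by (simp add: srw_position_def indicator_def)
next
  case (Suc n)
  interpret sequence_space "measure_pmf (pmf_of_set (lattice_neighbours_0 :: (int ^ 'd) set))"
    by (rule sequence_space_increments)
  let ?N = "measure_pmf (pmf_of_set (lattice_neighbours_0 :: (int ^ 'd) set))"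
  let ?S = "srw_increments :: (nat \<Rightarrow> int ^ 'd) measure"
  let ?A = "{\<xi>. srw_position \<xi> (Suc n) = x}"
  let ?f = "\<lambda>(e :: int ^ 'd, \<xi>). case_nat e \<xi>"
  have f[measurable]: "?f \<in> ?N \<Otimes>\<^sub>M ?S \<rightarrow>\<^sub>M ?S"
    unfolding srw_increments_def by measurable
  have "emeasure ?S ?A = emeasure (distr (?N \<Otimes>\<^sub>M ?S) ?S ?f) ?A"
    using PiM_iter by (simp add: srw_increments_def)
  also have "\<dots> = emeasure (?N \<Otimes>\<^sub>M ?S) (?f -` ?A \<inter> space (?N \<Otimes>\<^sub>M ?S))"
    by (intro emeasure_distr f sets_srw_position)
  also have "\<dots> = (\<integral>\<^sup>+e. emeasure ?S (Pair e -` (?f -` ?A \<inter> space (?N \<Otimes>\<^sub>M ?S))) \<partial>?N)"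
    by (intro sigma_finite_measure.emeasure_pair_measure_alt sigma_finite_srw_increments
        measurable_sets[OF f] sets_srw_position)
  also have "\<dots> = (\<integral>\<^sup>+e. emeasure ?S {\<xi>. srw_position \<xi> n = x - e} \<partial>?N)"
    by (intro nn_integral_cong arg_cong[where f = "emeasure ?S"])
      (auto simp: space_pair_measure space_srw_increments srw_position_case_nat)
  also have "\<dots> = (\<integral>\<^sup>+e. ennreal (pmf (map_pmf ((+) e) (srw_law n)) x) \<partial>?N)"
    by (simp add: Suc.IH pmf_map_translate)
  also have "\<dots> = ennreal (pmf (srw_law (Suc n)) x)"
    by (simp add: srw_step_def ennreal_pmf_bind)
  finally show ?case .
qed

section \<open>Decomposition at the last visit to the origin\<close>

text \<open>The probability that the walk does not return to the origin during its first \<open>m\<close> steps.\<close>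
definition no_return_prob :: "'d::finite itself \<Rightarrow> nat \<Rightarrow> real" where
  "no_return_prob _ m =
     measure (srw_increments :: (nat \<Rightarrow> int ^ 'd) measure) {\<xi>. \<forall>j\<in>{1..m}. srw_position \<xi> j \<noteq> 0}"

text \<open>The independence of the walk up to time \<open>k\<close> and its increments after time \<open>k\<close>: the path is obtained by
  concatenating the first \<open>k\<close> increments of one sequence with a second, independent sequence.\<close>
lemma measure_last_visit:
  assumes "k \<le> n"
  shows "measure (srw_increments :: (nat \<Rightarrow> int ^ 'd::finite) measure)
      {\<xi>. srw_position \<xi> k = 0 \<and> (\<forall>j\<in>{k<..n}. srw_position \<xi> j \<noteq> 0)} =
    pmf (srw_law k :: (int ^ 'd) pmf) 0 * no_return_prob TYPE('d) (n - k)"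
proof -
  interpret sequence_space "measure_pmf (pmf_of_set (lattice_neighbours_0 :: (int ^ 'd) set))"
    by (rule sequence_space_increments)
  interpret SR: prob_space "srw_increments :: (nat \<Rightarrow> int ^ 'd) measure"
    by (rule prob_space_srw_increments)
  let ?S = "srw_increments :: (nat \<Rightarrow> int ^ 'd) measure"
  let ?B = "{\<xi> :: nat \<Rightarrow> int ^ 'd. srw_position \<xi> k = 0}"
  let ?A = "?B \<inter> {\<xi>. \<forall>j\<in>{k<..n}. srw_position \<xi> j \<noteq> 0}"
  let ?C = "{\<xi> :: nat \<Rightarrow> int ^ 'd. \<forall>j\<in>{1..n - k}. srw_position \<xi> j \<noteq> 0}"
  let ?f = "\<lambda>(\<xi>, \<xi>'). comb_seq k \<xi> \<xi>' :: nat \<Rightarrow> int ^ 'd"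
  have f: "?f \<in> ?S \<Otimes>\<^sub>M ?S \<rightarrow>\<^sub>M ?S"
    unfolding srw_increments_def by (rule measurable_comb_seq)
  have A: "?A \<in> sets ?S"
    by (intro sets.Int sets_srw_position sets_no_return) simp
  have fA: "?f -` ?A \<inter> space (?S \<Otimes>\<^sub>M ?S) = ?B \<times> ?C"
  proof -
    have "(\<forall>j\<in>{k<..n}. srw_position (comb_seq k \<xi> \<xi>') j \<noteq> 0) \<longleftrightarrow> \<xi>' \<in> ?C"
      if "srw_position \<xi> k = 0" for \<xi> \<xi>' :: "nat \<Rightarrow> int ^ 'd"
    proof -
      have shift: "(\<forall>j\<in>{k<..n}. P j) \<longleftrightarrow> (\<forall>i\<in>{1..n - k}. P (k + i))" for P
      proof (intro iffI ballI)
        fix j assume "\<forall>i\<in>{1..n - k}. P (k + i)" "j \<in> {k<..n}"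
        then have "P (k + (j - k))" by (intro bspec[of "{1..n - k}" "\<lambda>i. P (k + i)"]) auto
        then show "P j" using \<open>j \<in> {k<..n}\<close> by simp
      qed auto
      show ?thesis unfolding shift using that by (simp add: srw_position_comb_seq_add)
    qed
    then show ?thesis
      by (auto simp: space_pair_measure space_srw_increments srw_position_comb_seq_le)
  qed
  have "emeasure ?S ?A = emeasure (distr (?S \<Otimes>\<^sub>M ?S) ?S ?f) ?A"
    using PiM_comb_seq by (simp add: srw_increments_def)
  also have "\<dots> = emeasure (?S \<Otimes>\<^sub>M ?S) (?B \<times> ?C)"
    using emeasure_distr[OF f A] fA by simp
  also have "\<dots> = emeasure ?S ?B * emeasure ?S ?C"
    by (intro SR.emeasure_pair_measure_Times sets_srw_position sets_no_return) simp
  also have "\<dots> = ennreal (pmf (srw_law k :: (int ^ 'd) pmf) 0) *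
      ennreal (no_return_prob TYPE('d) (n - k))"
    by (simp only: emeasure_srw_position no_return_prob_def SR.emeasure_eq_measure[of ?C])
  finally have "measure ?S ?A = pmf (srw_law k :: (int ^ 'd) pmf) 0 * no_return_prob TYPE('d) (n - k)"
    by (simp add: measure_def ennreal_mult[symmetric] no_return_prob_def)
  moreover have "?A = {\<xi>. srw_position \<xi> k = 0 \<and> (\<forall>j\<in>{k<..n}. srw_position \<xi> j \<noteq> 0)}"
    by auto
  ultimately show ?thesis by simp
qed

text \<open>The walk starts at the origin, so that there is exactly one last visit up to time \<open>n\<close>.\<close>
lemma last_visit_decomposition:
  "(\<Sum>k\<le>n. pmf (srw_law k :: (int ^ 'd::finite) pmf) 0 * no_return_prob TYPE('d) (n - k)) = 1"
proof -
  interpret SR: prob_space "srw_increments :: (nat \<Rightarrow> int ^ 'd) measure"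
    by (rule prob_space_srw_increments)
  let ?S = "srw_increments :: (nat \<Rightarrow> int ^ 'd) measure"
  define A :: "nat \<Rightarrow> (nat \<Rightarrow> int ^ 'd) set" where
    "A k = {\<xi>. srw_position \<xi> k = 0 \<and> (\<forall>j\<in>{k<..n}. srw_position \<xi> j \<noteq> 0)}" for k
  have sets: "A k \<in> sets ?S" for k
  proof -
    have "A k = {\<xi>. srw_position \<xi> k = 0} \<inter> {\<xi>. \<forall>j\<in>{k<..n}. srw_position \<xi> j \<noteq> 0}"
      by (auto simp: A_def)
    then show ?thesis
      by (auto intro!: sets.Int sets_srw_position sets_no_return)
  qed
  have disj: "disjoint_family_on A {..n}"
    unfolding disjoint_family_on_def A_def
    by (auto simp: set_eq_iff) (meson greaterThanAtMost_iff linorder_neqE_nat)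
  have cover: "\<xi> \<in> (\<Union>k\<le>n. A k)" for \<xi>
  proof -
    let ?Z = "{k. k \<le> n \<and> srw_position \<xi> k = 0}"
    have fin: "finite ?Z" by simp
    have "0 \<in> ?Z" by (simp add: srw_position_def)
    then have "Max ?Z \<in> ?Z" using Max_in[OF fin] by blast
    moreover have "srw_position \<xi> j \<noteq> 0" if "j \<in> {Max ?Z<..n}" for j
    proof
      assume "srw_position \<xi> j = 0"
      with that have "j \<in> ?Z" by simp
      with Max_ge[OF fin this] that show False by simp
    qed
    ultimately show ?thesis unfolding A_def by blast
  qed
  have "(\<Sum>k\<le>n. measure ?S (A k)) = measure ?S (\<Union>k\<le>n. A k)"
    using sets disj by (intro SR.finite_measure_finite_Union[symmetric]) auto
  also have "(\<Union>k\<le>n. A k) = space ?S"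
    using cover by (auto simp: space_srw_increments)
  finally show ?thesis
    by (simp add: A_def measure_last_visit SR.prob_space)
qed

lemma no_return_prob_bounds: "0 \<le> no_return_prob T m" "no_return_prob T m \<le> 1"
  unfolding no_return_prob_def using prob_space.prob_le_1[OF prob_space_srw_increments] by auto

lemma no_return_prob_antimono:
  assumes "m \<le> n"
  shows "no_return_prob TYPE('d::finite) n \<le> no_return_prob TYPE('d) m"
proof -
  interpret SR: prob_space "srw_increments :: (nat \<Rightarrow> int ^ 'd) measure"
    by (rule prob_space_srw_increments)
  show ?thesis
    unfolding no_return_prob_def using assms
    by (intro SR.finite_measure_mono sets_no_return) auto
qed

lemma no_return_prob_tendsto:
  "no_return_prob TYPE('d::finite) \<longlonglongrightarrow> srw_escape_prob TYPE('d)"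
proof -
  interpret SR: prob_space "srw_increments :: (nat \<Rightarrow> int ^ 'd) measure"
    by (rule prob_space_srw_increments)
  let ?A = "\<lambda>m. {\<xi> :: nat \<Rightarrow> int ^ 'd. \<forall>j\<in>{1..m}. srw_position \<xi> j \<noteq> 0}"
  have "(\<lambda>m. measure srw_increments (?A m)) \<longlonglongrightarrow> measure srw_increments (\<Inter>m. ?A m)"
    by (intro SR.finite_Lim_measure_decseq) (auto simp: decseq_def sets_no_return)
  moreover have "(\<Inter>m. ?A m) = {\<xi> \<in> space srw_increments. \<forall>n\<ge>1. srw_position \<xi> n \<noteq> 0}"
    by (auto simp: space_srw_increments) (metis atLeastAtMost_iff order_refl)
  ultimately show ?thesis
    by (simp add: srw_escape_prob_def no_return_prob_def[abs_def])
qed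

lemma srw_escape_prob_le_no_return_prob: "srw_escape_prob TYPE('d::finite) \<le> no_return_prob TYPE('d) m"
  by (intro LIMSEQ_le_const2[OF no_return_prob_tendsto]) (auto intro: no_return_prob_antimono)

section \<open>The generating function of the return probabilities\<close>

lemma return_gf_ge_1:
  assumes "0 \<le> s" "s < 1"
  shows "return_gf TYPE('d::finite) s \<ge> 1"
  using sum_le_suminf[OF summable_return_gf[OF assms, where 'd = 'd], of "{0}"] assms
  by (simp add: return_gf_def)

lemma return_gf_mono:
  assumes "0 \<le> s" "s \<le> t" "t < 1"
  shows "return_gf TYPE('d::finite) s \<le> return_gf TYPE('d) t"
  unfolding return_gf_def using assms
  by (intro suminf_le summable_return_gf mult_left_mono power_mono) auto

lemma continuous_on_return_gf:
  assumes "0 \<le> t" "t < 1"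
  shows "continuous_on {0..t} (return_gf TYPE('d::finite))"
proof -
  obtain u where u: "t < u" "u < 1" using dense[OF assms(2)] by auto
  have "isCont (return_gf TYPE('d)) s" if "s \<in> {0..t}" for s
    unfolding return_gf_def
    by (rule isCont_powser[where K = u]) (use u that assms in \<open>auto intro!: summable_return_gf\<close>)
  then show ?thesis by (auto intro: continuous_at_imp_continuous_on)
qed

text \<open>The last-visit decomposition, read as a Cauchy product of power series.\<close>
lemma return_gf_times_no_return_gf:
  assumes "0 \<le> s" "s < 1"
  shows "return_gf TYPE('d::finite) s * (\<Sum>m. no_return_prob TYPE('d) m * s ^ m) = 1 / (1 - s)"
proof -
  let ?p = "\<lambda>n. pmf (srw_law n :: (int ^ 'd) pmf) 0"
  let ?r = "no_return_prob TYPE('d)"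
  have "summable (\<lambda>n. norm (?p n * s ^ n))" "summable (\<lambda>n. norm (?r n * s ^ n))"
    using assms summable_bounded_powser[of ?p s] summable_bounded_powser[of ?r s]
    by (simp_all add: pmf_le_1 no_return_prob_bounds)
  then have "(\<lambda>n. \<Sum>k\<le>n. (?p k * s ^ k) * (?r (n - k) * s ^ (n - k)))
      sums ((\<Sum>n. ?p n * s ^ n) * (\<Sum>m. ?r m * s ^ m))"
    by (rule Cauchy_product_sums)
  moreover have "(\<Sum>k\<le>n. (?p k * s ^ k) * (?r (n - k) * s ^ (n - k))) = s ^ n" for n
  proof -
    have "(?p k * s ^ k) * (?r (n - k) * s ^ (n - k)) = s ^ n * (?p k * ?r (n - k))" if "k \<le> n" for k
      using that power_add[of s k "n - k"] by simp
    then have "(\<Sum>k\<le>n. (?p k * s ^ k) * (?r (n - k) * s ^ (n - k))) =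
        (\<Sum>k\<le>n. s ^ n * (?p k * ?r (n - k)))"
      by (intro sum.cong) auto
    then show ?thesis
      by (simp only: sum_distrib_left[symmetric] last_visit_decomposition mult_1_right)
  qed
  moreover have "(\<lambda>n. s ^ n) sums (1 / (1 - s))"
    using assms by (intro geometric_sums) simp
  ultimately show ?thesis unfolding return_gf_def by (simp add: sums_unique2)
qed

lemma escape_prob_times_return_gf_less_1:
  assumes "0 < s" "s < 1" "\<delta> \<le> srw_escape_prob TYPE('d::finite)"
  shows "\<delta> * (s * return_gf TYPE('d) s) < 1"
proof -
  let ?g = "srw_escape_prob TYPE('d)" and ?r = "no_return_prob TYPE('d)"
  have G: "return_gf TYPE('d) s \<ge> 1" using assms return_gf_ge_1[of s] by simp
  have "?g / (1 - s) = (\<Sum>m. ?g * s ^ m)"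
    using assms by (simp add: suminf_mult summable_geometric suminf_geometric)
  also have "\<dots> \<le> (\<Sum>m. ?r m * s ^ m)"
    using assms summable_bounded_powser[of ?r s]
    by (intro suminf_le mult_right_mono srw_escape_prob_le_no_return_prob summable_mult
        summable_geometric) (auto simp: no_return_prob_bounds intro: summable_rabs_cancel)
  finally have "return_gf TYPE('d) s * (?g / (1 - s)) \<le> return_gf TYPE('d) s * (\<Sum>m. ?r m * s ^ m)"
    using G by (intro mult_left_mono) auto
  also have "\<dots> = 1 / (1 - s)"
    using assms by (intro return_gf_times_no_return_gf) auto
  finally have "return_gf TYPE('d) s * (?g / (1 - s)) \<le> 1 / (1 - s)" .
  then have "?g * return_gf TYPE('d) s \<le> 1"
    using assms by (simp add: divide_le_cancel mult.commute)
  then have "\<delta> * return_gf TYPE('d) s \<le> 1"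
    using G by (intro order_trans[OF mult_right_mono[OF assms(3)]]) auto
  then have "s * (\<delta> * return_gf TYPE('d) s) \<le> s * 1"
    using assms by (intro mult_left_mono) auto
  then have "\<delta> * (s * return_gf TYPE('d) s) \<le> s"
    by (simp add: mult.left_commute)
  then show ?thesis using assms(2) by simp
qed

lemma ex_return_gf_greater:
  assumes "\<delta> > srw_escape_prob TYPE('d::finite)"
  shows "\<exists>s. 0 < s \<and> s < 1 \<and> \<delta> * (s * return_gf TYPE('d) s) > 1"
proof -
  let ?r = "no_return_prob TYPE('d)"
  obtain m where m: "?r m < \<delta>"
    using order_tendstoD(2)[OF no_return_prob_tendsto assms] by (auto simp: eventually_sequentially)
  have rm: "0 \<le> ?r m" by (rule no_return_prob_bounds)
  \<comment> \<open>With \<open>r n \<le> 1\<close> for \<open>n < m\<close> and \<open>r n \<le> r m\<close> otherwise, \<open>1 / G s \<le> m * (1 - s) + r m\<close>.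
    The value of \<open>s\<close> is chosen so that this is less than \<open>\<delta> * s\<close>, with half of the gap
    \<open>\<delta> - r m\<close> to spare.\<close>
  define s where "s = 1 - (\<delta> - ?r m) / (2 * (\<delta> + m))"
  have s: "0 < s" "s < 1" "(1 - s) * (\<delta> + m) = (\<delta> - ?r m) / 2"
    using m rm by (auto simp: s_def field_simps)
  have G: "return_gf TYPE('d) s \<ge> 1" using s return_gf_ge_1[of s] by simp
  have sm: "(\<lambda>n. (if n < m then 1 else 0) + ?r m * s ^ n) sums (real m + ?r m * (1 / (1 - s)))"
    using s sums_If_finite[of "\<lambda>n. n < m" "\<lambda>_. 1 :: real"]
    by (intro sums_add sums_mult geometric_sums) auto
  have "(\<Sum>n. ?r n * s ^ n) \<le> (\<Sum>n. (if n < m then 1 else 0) + ?r m * s ^ n)"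
  proof (intro suminf_le allI)
    fix n
    show "?r n * s ^ n \<le> (if n < m then 1 else 0) + ?r m * s ^ n"
    proof (cases "n < m")
      case True
      then show ?thesis
        using s rm no_return_prob_bounds[of "TYPE('d)" n] mult_le_one[of "?r n" "s ^ n"]
        by (auto simp: power_le_one intro: add_increasing2)
    next
      case False
      then show ?thesis using s no_return_prob_antimono[of m n, where 'd = 'd]
        by (simp add: mult_right_mono)
    qed
  next
    show "summable (\<lambda>n. ?r n * s ^ n)"
      using s summable_bounded_powser[of ?r s]
      by (auto simp: no_return_prob_bounds intro: summable_rabs_cancel)
  qed (use sm in \<open>simp add: sums_iff\<close>)
  also have "\<dots> = real m + ?r m * (1 / (1 - s))"
    using sm by (simp add: sums_iff)
  finally have "return_gf TYPE('d) s * (\<Sum>n. ?r n * s ^ n) \<le>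
      return_gf TYPE('d) s * (real m + ?r m * (1 / (1 - s)))"
    using G by (intro mult_left_mono) auto
  then have "1 / (1 - s) \<le> return_gf TYPE('d) s * (real m + ?r m * (1 / (1 - s)))"
    using s by (subst (asm) return_gf_times_no_return_gf) auto
  then have "1 \<le> return_gf TYPE('d) s * (real m * (1 - s) + ?r m)"
    using s by (simp add: field_simps)
  also have "\<dots> < return_gf TYPE('d) s * (\<delta> * s)"
  proof -
    have "real m * (1 - s) + ?r m < \<delta> * s" using s(3) m by (simp add: field_simps)
    then show ?thesis using G by (intro mult_strict_left_mono) auto
  qed
  finally show ?thesis using s by (auto simp: mult_ac)
qed

text \<open>In fact \<open>s * G s\<close> is strictly increasing, since \<open>G\<close> is positive and nondecreasing.\<close>
lemma return_gf_inj:
  assumes "0 < s" "s < 1" "0 < t" "t < 1" "s * return_gf TYPE('d::finite) s = t * return_gf TYPE('d) t"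
  shows "s = t"
proof -
  have "u * return_gf TYPE('d) u < v * return_gf TYPE('d) v" if "0 < u" "u < v" "v < 1" for u v
  proof (rule mult_less_le_imp_less)
    show "return_gf TYPE('d) u \<le> return_gf TYPE('d) v"
      using that by (intro return_gf_mono) auto
    show "0 < return_gf TYPE('d) u"
      using that return_gf_ge_1[of u, where 'd = 'd] by simp
  qed (use that in auto)
  from this[of s t] this[of t s] show ?thesis
    using assms by (cases s t rule: linorder_cases) auto
qed

section \<open>Existence and uniqueness for the system\<close>

theorem theorem1p3:
  fixes lam0 lam :: real
  assumes "lam > 0" and "lam0 \<ge> lam"
  shows "(0 \<le> lam0 - lam \<and> lam0 - lam \<le> srw_escape_prob TYPE('d::finite) \<longrightarrow>
            \<not> (\<exists>\<nu> :: (int ^ 'd) pmf. satisfies_system lam0 lam \<nu>)) \<and>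
         (lam0 - lam > srw_escape_prob TYPE('d) \<longrightarrow>
            (\<exists>!\<nu> :: (int ^ 'd) pmf. satisfies_system lam0 lam \<nu>))"
proof (intro conjI impI notI; (elim conjE exE)?)
  fix \<nu> :: "(int ^ 'd) pmf"
  assume "lam0 - lam \<le> srw_escape_prob TYPE('d)" "satisfies_system lam0 lam \<nu>"
  then obtain s where "0 < s" "s < 1" "(lam0 - lam) * (s * return_gf TYPE('d) s) = 1"
    using assms(2) by (elim satisfies_system_imp_killed_walk_law) auto
  then show False
    using escape_prob_times_return_gf_less_1[of s "lam0 - lam", where 'd = 'd]
      \<open>lam0 - lam \<le> srw_escape_prob TYPE('d)\<close> by simp
next
  assume gt: "lam0 - lam > srw_escape_prob TYPE('d)"
  let ?\<phi> = "\<lambda>s. (lam0 - lam) * (s * return_gf TYPE('d) s)"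
  obtain t where t: "0 < t" "t < 1" "?\<phi> t > 1"
    using ex_return_gf_greater[OF gt] by blast
  have "\<exists>s\<ge>0. s \<le> t \<and> ?\<phi> s = 1"
    using t by (intro IVT') (auto intro!: continuous_intros continuous_on_return_gf)
  then obtain s where s: "0 \<le> s" "s \<le> t" "?\<phi> s = 1" by blast
  then have s0: "0 < s" by (cases "s = 0") auto
  have s1: "s < 1" using s t by simp
  show "\<exists>!\<nu> :: (int ^ 'd) pmf. satisfies_system lam0 lam \<nu>"
  proof (rule ex1I)
    show "satisfies_system lam0 lam (killed_walk_law s :: (int ^ 'd) pmf)"
      by (rule satisfies_system_killed_walk_law[OF s0 s1 s(3)])
  next
    fix \<mu> :: "(int ^ 'd) pmf" assume "satisfies_system lam0 lam \<mu>"
    then obtain u where u: "0 < u" "u < 1" "\<mu> = killed_walk_law u" "?\<phi> u = 1"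
      using assms(2) by (rule satisfies_system_imp_killed_walk_law)
    have "u * return_gf TYPE('d) u = s * return_gf TYPE('d) s"
      using u(4) s(3) by (metis mult_cancel_left mult_zero_left zero_neq_one)
    then have "u = s"
      by (rule return_gf_inj[OF u(1,2) s0 s1])
    then show "\<mu> = killed_walk_law s" using u by simp
  qed
qed

end
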